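(* Let $0<p\le1$. Then there exists a martingale $f\in H_p$ such that $$\|L^{*}f\|_p=+\infty ,$$ where $L^{*}f:=\sup_{n\ge2}|L_nf|$ is the maximal operator of the Nörlund logarithmic means.
   Context: $\mathbb N_+$ is the set of positive integers, $\mathbb N=\mathbb N_+\cup\{0\}$. Fix a bounded sequence $m=(m_0,m_1,\dots)$ of integers $m_k\ge 2$. $G_m=\prod_{k\ge0}Z_{m_k}$, where $Z_{m_k}=\{0,\dots,m_k-1\}$ is the additive group modulo $m_k$, with the product of the discrete topologies; $\mu$ is the Haar measure with $\mu(G_m)=1$. $M_0:=1$, $M_{k+1}:=m_kM_k$; every $n\in\mathbb N$ is uniquely $n=\sum_{j\ge0}n_jM_j$ with $n_j\in Z_{m_j}$. $r_k(x):=\exp(2\pi i x_k/m_k)$, $\psi_n:=\prod_{k\ge0}r_k^{n_k}$ (Vilenkin system). $I_0(x):=G_m$, $I_n(x):=\{y: y_0=x_0,\dots,y_{n-1}=x_{n-1}\}$; $\mathcal F_n$ is the $\sigma$-algebra generated by $\{I_n(x):x\in G_m\}$. For $g\in L_1(G_m)$: $\widehat g(k):=\int g\overline{\psi_k}\,d\mu$, $S_ng:=\sum_{k=0}^{n-1}\widehat g(k)\psi_k$. A martingale is a sequence $f=(f^{(n)}:n\in\mathbb N)$ of integrable functions with $f^{(n)}$ $\mathcal F_n$-measurable and $S_{M_n}f^{(k)}=f^{(n)}$ for $n\le k$; $f^*:=\sup_n|f^{(n)}|$; $H_p$ is the set of martingales with $\|f\|_{H_p}:=\|f^*\|_p<\infty$,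 where $\|g\|_p:=(\int|g|^pd\mu)^{1/p}$. For a martingale, $\widehat f(i):=\lim_k\int f^{(k)}\overline{\psi_i}\,d\mu$ and $S_nf:=\sum_{k=0}^{n-1}\widehat f(k)\psi_k$. The Nörlund logarithmic means are $L_nf:=\frac1{l_n}\sum_{k=1}^{n-1}\frac{S_kf}{n-k}$ with $l_n:=\sum_{k=1}^{n-1}\frac1k$ ($n\ge2$). *)

theory Defs
  imports "HOL-Probability.Probability"
begin

definition vilenkin_measure :: "(nat \<Rightarrow> nat) \<Rightarrow> (nat \<Rightarrow> nat) measure" where
  "vilenkin_measure m = PiM UNIV (\<lambda>k. uniform_count_measure {..<m k})"

abbreviation vilenkin_group :: "(nat \<Rightarrow> nat) \<Rightarrow> (nat \<Rightarrow> nat) set" where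
  "vilenkin_group m \<equiv> space (vilenkin_measure m)"

text \<open>
  Each factor is finite and discrete, so the product \<open>\<sigma>\<close>-algebra is the Borel \<open>\<sigma>\<close>-algebra of the
  product topology. The product of the uniform probability measures is the normalized Haar measure:
  it is a probability measure and it is invariant under the group translations.
\<close>

lemma space_vilenkin_measure: "vilenkin_group m = {x. \<forall>k. x k < m k}"
  by (auto simp: vilenkin_measure_def space_PiM space_uniform_count_measure PiE_def Pi_def)

lemma prob_space_vilenkin_measure:
  assumes "\<And>k. 2 \<le> m k"
  shows "prob_space (vilenkin_measure m)"
  unfolding vilenkin_measure_def
proof (rule prob_space_PiM)
  fix k
  have "0 < m k"
    using assms[of k] by simp
  then show "prob_space (uniform_count_measure {..<m k})"
    by (intro prob_space_uniform_count_measure) (auto simp: lessThan_empty_iff)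
qed

definition vilenkin_add :: "(nat \<Rightarrow> nat) \<Rightarrow> (nat \<Rightarrow> nat) \<Rightarrow> (nat \<Rightarrow> nat) \<Rightarrow> (nat \<Rightarrow> nat)" where
  "vilenkin_add m a x = (\<lambda>k. (a k + x k) mod m k)"

lemma bij_betw_add_mod:
  assumes "0 < (n::nat)"
  shows "bij_betw (\<lambda>x. (a + x) mod n) {..<n} {..<n}"
proof -
  have inj: "inj_on (\<lambda>x. (a + x) mod n) {..<n}"
  proof (rule inj_onI)
    fix x y assume "x \<in> {..<n}" "y \<in> {..<n}" "(a + x) mod n = (a + y) mod n"
    then obtain q r where "a + x + n * q = a + y + n * r"
      by (metis nat_mod_eq_iff)
    then have "x mod n = y mod n"
      by (metis add.assoc add_left_cancel mod_mult_self2)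
    with \<open>x \<in> {..<n}\<close> \<open>y \<in> {..<n}\<close> show "x = y"
      by simp
  qed
  have "(\<lambda>x. (a + x) mod n) ` {..<n} \<subseteq> {..<n}"
    using assms by auto
  with inj show ?thesis
    by (simp add: bij_betw_def endo_inj_surj)
qed

lemma vilenkin_measure_translation_invariant:
  assumes m: "\<And>k. 2 \<le> m k"
  shows "distr (vilenkin_measure m) (vilenkin_measure m) (vilenkin_add m a) = vilenkin_measure m"
proof -
  let ?U = "\<lambda>k. uniform_count_measure {..<m k}"
  let ?h = "\<lambda>k x. (a k + x) mod m k"
  have pos: "0 < m k" for k
    using m[of k] by simp
  have sp: "space (PiM UNIV ?U) = {x. \<forall>k. x k < m k}"
    using space_vilenkin_measure[of m] by (simp add: vilenkin_measure_def)
  have U: "prob_space (?U k)" for k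
    by (intro prob_space_uniform_count_measure) (use pos[of k] in \<open>auto simp: lessThan_empty_iff\<close>)
  interpret P: product_prob_space ?U UNIV
    by (intro product_prob_spaceI U)
  have h: "?h k \<in> ?U k \<rightarrow>\<^sub>M ?U k" for k
    using pos[of k]
    by (auto simp: measurable_def space_uniform_count_measure sets_uniform_count_measure)
  have add: "vilenkin_add m a \<in> PiM UNIV ?U \<rightarrow>\<^sub>M PiM UNIV ?U"
    unfolding vilenkin_add_def
  proof (rule measurable_PiM_single')
    fix i :: nat
    show "(\<lambda>x. (a i + x i) mod m i) \<in> PiM UNIV ?U \<rightarrow>\<^sub>M ?U i"
      using measurable_compose[OF measurable_component_singleton[of i UNIV ?U] h[of i]] by simp
  qed (use pos in \<open>auto simp: space_PiM space_uniform_count_measure\<close>)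
  have card_eq: "emeasure (?U k) (?h k -` A \<inter> space (?U k)) = emeasure (?U k) A"
    if A: "A \<in> sets (?U k)" for k A
  proof -
    have A': "A \<subseteq> {..<m k}"
      using A by (simp add: sets_uniform_count_measure)
    have "bij_betw (?h k) (?h k -` A \<inter> {..<m k}) A"
    proof (rule bij_betw_subset[OF bij_betw_add_mod[OF pos[of k], of "a k"]])
      show "?h k -` A \<inter> {..<m k} \<subseteq> {..<m k}" by auto
      have "?h k ` {..<m k} = {..<m k}"
        using bij_betw_add_mod[OF pos[of k], of "a k"] by (simp add: bij_betw_def)
      moreover have "?h k ` (?h k -` A \<inter> {..<m k}) = A \<inter> ?h k ` {..<m k}"
        by auto
      ultimately show "?h k ` (?h k -` A \<inter> {..<m k}) = A"
        using A' by auto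
    qed
    then have "card (?h k -` A \<inter> {..<m k}) = card A"
      by (rule bij_betw_same_card)
    with A' show ?thesis
      by (simp add: emeasure_uniform_count_measure space_uniform_count_measure)
  qed
  have "distr (PiM UNIV ?U) (PiM UNIV ?U) (vilenkin_add m a) = PiM UNIV ?U"
  proof (rule P.PiM_eq)
    fix J F assume J: "finite J" "J \<subseteq> (UNIV :: nat set)" "\<And>j. j \<in> J \<Longrightarrow> F j \<in> sets (?U j)"
    let ?E = "\<lambda>F. prod_emb UNIV ?U J (PiE J F)"
    have E: "?E F \<in> sets (PiM UNIV ?U)"
      using J by (intro sets_PiM_I) auto
    have mem: "x \<in> ?E G \<longleftrightarrow> (\<forall>k. x k < m k) \<and> (\<forall>j\<in>J. x j \<in> G j)" for x G
      by (auto simp: prod_emb_def space_uniform_count_measure PiE_UNIV_domain)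
    have "vilenkin_add m a -` ?E F \<inter> space (PiM UNIV ?U)
        = ?E (\<lambda>j. ?h j -` F j \<inter> space (?U j))" (is "?L = ?R")
    proof (rule set_eqI)
      fix x show "x \<in> ?L \<longleftrightarrow> x \<in> ?R"
        using pos by (auto simp: mem sp vilenkin_add_def space_uniform_count_measure)
    qed
    then have "emeasure (distr (PiM UNIV ?U) (PiM UNIV ?U) (vilenkin_add m a)) (?E F)
        = emeasure (PiM UNIV ?U) (?E (\<lambda>j. ?h j -` F j \<inter> space (?U j)))"
      by (simp add: emeasure_distr[OF add E])
    also have "\<dots> = (\<Prod>j\<in>J. emeasure (?U j) (?h j -` F j \<inter> space (?U j)))"
      using J measurable_sets[OF h] by (intro P.emeasure_PiM_emb) auto
    also have "\<dots> = (\<Prod>j\<in>J. emeasure (?U j) (F j))"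
      using J by (intro prod.cong refl card_eq) auto
    finally show "emeasure (distr (PiM UNIV ?U) (PiM UNIV ?U) (vilenkin_add m a)) (?E F)
        = (\<Prod>j\<in>J. emeasure (?U j) (F j))" .
  qed simp
  then show ?thesis
    by (simp add: vilenkin_measure_def)
qed

definition vilenkin_cylinder :: "(nat \<Rightarrow> nat) \<Rightarrow> nat \<Rightarrow> (nat \<Rightarrow> nat) \<Rightarrow> (nat \<Rightarrow> nat) set" where
  "vilenkin_cylinder m n x = {y \<in> vilenkin_group m. \<forall>j<n. y j = x j}"

definition vilenkin_filtration :: "(nat \<Rightarrow> nat) \<Rightarrow> nat \<Rightarrow> (nat \<Rightarrow> nat) measure" where
  "vilenkin_filtration m n =
     sigma (vilenkin_group m) (vilenkin_cylinder m n ` vilenkin_group m)"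

primrec gen_power :: "(nat \<Rightarrow> nat) \<Rightarrow> nat \<Rightarrow> nat" where
  "gen_power m 0 = 1"
| "gen_power m (Suc k) = m k * gen_power m k"

definition gen_digit :: "(nat \<Rightarrow> nat) \<Rightarrow> nat \<Rightarrow> nat \<Rightarrow> nat" where
  "gen_digit m n j = (n div gen_power m j) mod m j"

lemma gen_digit_less:
  assumes "\<And>k. 2 \<le> m k"
  shows "gen_digit m n j < m j"
  using assms[of j] by (simp add: gen_digit_def)

lemma gen_digit_expansion: "n mod gen_power m N = (\<Sum>j<N. gen_digit m n j * gen_power m j)"
proof (induction N)
  case (Suc N)
  have "n mod (gen_power m N * m N)
      = gen_power m N * (n div gen_power m N mod m N) + n mod gen_power m N"
    by (rule mod_mult2_eq)
  with Suc show ?case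
    by (simp add: gen_digit_def ac_simps)
qed simp

lemma less_gen_power:
  assumes "\<And>k. 2 \<le> m k"
  shows "n < gen_power m n"
proof (induction n)
  case (Suc n)
  have "Suc n \<le> gen_power m n"
    using Suc by simp
  also have "\<dots> < 2 * gen_power m n"
    using Suc by simp
  also have "\<dots> \<le> m n * gen_power m n"
    using assms[of n] by (rule mult_right_mono) simp
  finally show ?case
    by simp
qed simp

lemma gen_digit_eq_0:
  assumes "\<And>k. 2 \<le> m k" "n \<le> j"
  shows "gen_digit m n j = 0"
proof -
  have "n < gen_power m j"
    using less_gen_power[of m j] assms by (meson le_less_trans)
  then show ?thesis
    by (simp add: gen_digit_def)
qed

lemma gen_digit_sum:
  assumes "\<And>k. 2 \<le> m k"
  shows "n = (\<Sum>j<n. gen_digit m n j * gen_power m j)"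
  using gen_digit_expansion[of n m n] less_gen_power[OF assms, of n] by simp

definition rademacher :: "(nat \<Rightarrow> nat) \<Rightarrow> nat \<Rightarrow> (nat \<Rightarrow> nat) \<Rightarrow> complex" where
  "rademacher m k x = exp (2 * of_real pi * \<i> * of_nat (x k) / of_nat (m k))"

text \<open>The factors with digit \<open>0\<close> equal \<open>1\<close>; only finitely many digits are nonzero.\<close>

definition vilenkin_fun :: "(nat \<Rightarrow> nat) \<Rightarrow> nat \<Rightarrow> (nat \<Rightarrow> nat) \<Rightarrow> complex" where
  "vilenkin_fun m n x = (\<Prod>k | gen_digit m n k \<noteq> 0. rademacher m k x ^ gen_digit m n k)"

definition fourier_coeff :: "(nat \<Rightarrow> nat) \<Rightarrow> ((nat \<Rightarrow> nat) \<Rightarrow> complex) \<Rightarrow> nat \<Rightarrow> complex" where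
  "fourier_coeff m g k = (\<integral>x. g x * cnj (vilenkin_fun m k x) \<partial>vilenkin_measure m)"

definition partial_sum ::
  "(nat \<Rightarrow> nat) \<Rightarrow> nat \<Rightarrow> ((nat \<Rightarrow> nat) \<Rightarrow> complex) \<Rightarrow> (nat \<Rightarrow> nat) \<Rightarrow> complex" where
  "partial_sum m n g x = (\<Sum>k<n. fourier_coeff m g k * vilenkin_fun m k x)"

definition vilenkin_martingale ::
  "(nat \<Rightarrow> nat) \<Rightarrow> (nat \<Rightarrow> (nat \<Rightarrow> nat) \<Rightarrow> complex) \<Rightarrow> bool" where
  "vilenkin_martingale m f \<longleftrightarrow>
     (\<forall>n. integrable (vilenkin_measure m) (f n) \<and> f n \<in> borel_measurable (vilenkin_filtration m n)) \<and>
     (\<forall>n k. n \<le> k \<longrightarrow> (\<forall>x\<in>vilenkin_group m. partial_sum m (gen_power m n) (f k) x = f n x))"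

definition martingale_maximal :: "(nat \<Rightarrow> (nat \<Rightarrow> nat) \<Rightarrow> complex) \<Rightarrow> (nat \<Rightarrow> nat) \<Rightarrow> ennreal" where
  "martingale_maximal f x = (SUP n. ennreal (cmod (f n x)))"

text \<open>The power \<open>t\<^sup>a\<close> for \<open>t \<in> [0, \<infinity>]\<close> and a real exponent \<open>a > 0\<close>.\<close>

definition ennpowr :: "ennreal \<Rightarrow> real \<Rightarrow> ennreal" where
  "ennpowr t a = (if t = \<infinity> then \<infinity> else ennreal (enn2real t powr a))"

definition Lp_quasinorm :: "(nat \<Rightarrow> nat) \<Rightarrow> real \<Rightarrow> ((nat \<Rightarrow> nat) \<Rightarrow> ennreal) \<Rightarrow> ennreal" where
  "Lp_quasinorm m p g = ennpowr (\<integral>\<^sup>+ x. ennpowr (g x) p \<partial>vilenkin_measure m) (1 / p)"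

definition hardy_space ::
  "(nat \<Rightarrow> nat) \<Rightarrow> real \<Rightarrow> (nat \<Rightarrow> (nat \<Rightarrow> nat) \<Rightarrow> complex) set" where
  "hardy_space m p =
     {f. vilenkin_martingale m f \<and> Lp_quasinorm m p (martingale_maximal f) < \<infinity>}"

text \<open>For a martingale, the sequence under the limit is eventually constant, so the limit exists.\<close>

definition martingale_coeff ::
  "(nat \<Rightarrow> nat) \<Rightarrow> (nat \<Rightarrow> (nat \<Rightarrow> nat) \<Rightarrow> complex) \<Rightarrow> nat \<Rightarrow> complex" where
  "martingale_coeff m f i = lim (\<lambda>k. fourier_coeff m (f k) i)"

definition martingale_partial_sum ::
  "(nat \<Rightarrow> nat) \<Rightarrow> nat \<Rightarrow> (nat \<Rightarrow> (nat \<Rightarrow> nat) \<Rightarrow> complex) \<Rightarrow> (nat \<Rightarrow> nat) \<Rightarrow> complex" where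
  "martingale_partial_sum m n f x = (\<Sum>k<n. martingale_coeff m f k * vilenkin_fun m k x)"

definition log_weight :: "nat \<Rightarrow> real" where
  "log_weight n = (\<Sum>k=1..<n. 1 / real k)"

definition norlund_log_mean ::
  "(nat \<Rightarrow> nat) \<Rightarrow> nat \<Rightarrow> (nat \<Rightarrow> (nat \<Rightarrow> nat) \<Rightarrow> complex) \<Rightarrow> (nat \<Rightarrow> nat) \<Rightarrow> complex" where
  "norlund_log_mean m n f x =
     1 / of_real (log_weight n) * (\<Sum>k=1..<n. martingale_partial_sum m k f x / of_nat (n - k))"

definition norlund_log_maximal ::
  "(nat \<Rightarrow> nat) \<Rightarrow> (nat \<Rightarrow> (nat \<Rightarrow> nat) \<Rightarrow> complex) \<Rightarrow> (nat \<Rightarrow> nat) \<Rightarrow> ennreal" where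
  "norlund_log_maximal m f x = (SUP n\<in>{2..}. ennreal (cmod (norlund_log_mean m n f x)))"

end

theory Submission
  imports Defs "HOL-Real_Asymp.Real_Asymp"
begin

text \<open>
  Take a lacunary martingale whose Vilenkin coefficients equal \<open>b\<^sub>i = w\<^sub>i\<^bsup>1/p\<^esup> M\<^sub>i\<^bsup>1/p-1\<^esup>\<close>, with
  \<open>w\<^sub>i = i\<^bsup>-1/2\<^esup>\<close>, on the blocks \<open>[M\<^sub>i, M\<^bsub>i+1\<^esub>)\<close> with \<open>i\<close> in a sparse set of even numbers. Each block
  is an atom, so the \<open>p\<close>-th power of the \<open>H\<^sub>p\<close> quasinorm is at most a constant times the sum of the
  chosen \<open>w\<^sub>i\<close>. For \<open>i = 2t\<close>, \<open>t \<le> s < 2t\<close> and \<open>n = M\<^sub>i + M\<^sub>s\<close>, on the cylinder \<open>I\<^sub>s(0)\<close>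
  the part of the mean coming from the block \<open>i\<close> is a unimodular factor times
  \<open>b\<^sub>i / l\<^sub>n\<close> times the sum of \<open>k / (M\<^sub>s - k)\<close> over \<open>k < M\<^sub>s\<close>, hence of size \<open>b\<^sub>i M\<^sub>s\<close>, because
  the sum is about \<open>s M\<^sub>s\<close> while \<open>l\<^sub>n\<close> is about \<open>t\<close>. So each of the \<open>t\<close> disjoint sets
  \<open>I\<^sub>s(0) - I\<^bsub>s+1\<^esub>(0)\<close> contributes at least a constant times \<open>w\<^sub>i\<close> to the integral of the \<open>p\<close>-th
  power of the maximal function, in total a multiple of \<open>\<surd>t\<close>.
\<close>

subsection \<open>Powers of extended numbers, logarithmic weights, sparse sequences\<close>

text \<open>After division by the total \<open>S\<close> every ratio lies in [0, 1], where u \<le> u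
  powr p because p \<le> 1, and the ratios add up to 1. This replaces the triangle inequality for
  the p-th power of the quasinorm.\<close>

lemma powr_sum_le:
  fixes t :: "'a \<Rightarrow> real"
  assumes p: "0 < p" "p \<le> 1" and t: "\<And>i. i \<in> A \<Longrightarrow> 0 \<le> t i"
  shows "(\<Sum>i\<in>A. t i) powr p \<le> (\<Sum>i\<in>A. t i powr p)"
proof -
  define S where "S = (\<Sum>i\<in>A. t i)"
  have S: "0 \<le> S"
    unfolding S_def by (rule sum_nonneg) (rule t)
  show ?thesis
  proof (cases "S = 0")
    case False
    \<comment> \<open>A sum over an infinite set is 0 by convention, so \<open>S \<noteq> 0\<close>
      forces finiteness.\<close>
    have "finite A"
      using False by (auto simp: S_def intro: ccontr)
    have "t i / S \<le> (t i / S) powr p" if "i \<in> A" for i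
    proof (cases "t i = 0")
      case False
      have "t i \<le> S"
        unfolding S_def using \<open>finite A\<close> that t by (intro member_le_sum) auto
      then have "(t i / S) powr 1 \<le> (t i / S) powr p"
        using p False t[OF that] S \<open>S \<noteq> 0\<close> by (intro powr_mono') auto
      then show ?thesis
        using False t[OF that] S \<open>S \<noteq> 0\<close> by simp
    qed simp
    then have "(\<Sum>i\<in>A. t i / S) \<le> (\<Sum>i\<in>A. (t i / S) powr p)"
      by (rule sum_mono)
    also have "(\<Sum>i\<in>A. t i / S) = 1"
      using False by (simp add: S_def flip: sum_divide_distrib)
    also have "(\<Sum>i\<in>A. (t i / S) powr p) = (\<Sum>i\<in>A. t i powr p) / S powr p"
      using t S by (simp add: powr_divide sum_divide_distrib)
    finally show ?thesis
      using False S by (simp add: field_simps flip: S_def)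
  qed (simp add: sum_nonneg flip: S_def)
qed

lemma ennpowr_ennreal: "0 \<le> r \<Longrightarrow> ennpowr (ennreal r) a = ennreal (r powr a)"
  by (simp add: ennpowr_def)

lemma ennpowr_mono:
  assumes "s \<le> t" "0 \<le> a"
  shows "ennpowr s a \<le> ennpowr t a"
proof (cases "t = \<infinity>")
  case False
  then obtain r where r: "t = ennreal r" "0 \<le> r"
    by (cases t) auto
  then obtain q where q: "s = ennreal q" "0 \<le> q"
    using assms(1) by (cases s) (auto simp: top_unique)
  show ?thesis
    using assms r q by (auto simp: ennpowr_ennreal intro!: powr_mono2 ennreal_leI)
qed (simp add: ennpowr_def)

lemma ennpowr_eq_infinity_iff: "ennpowr t a = \<infinity> \<longleftrightarrow> t = \<infinity>"
  by (simp add: ennpowr_def)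

text \<open>For finite \<open>T\<close> the p-th root turns the assumption into a common bound on
  all \<open>u n\<close>; this bound passes to the supremum and is raised to the power
  \<open>p\<close> again.\<close>

lemma ennpowr_SUP_le:
  assumes p: "0 < p" and u: "\<And>n. ennpowr (u n) p \<le> T"
  shows "ennpowr (SUP n. u n) p \<le> T"
proof (cases "T = \<infinity>")
  case False
  then obtain r where r: "T = ennreal r" "0 \<le> r"
    by (cases T) auto
  have "u n \<le> ennreal (r powr (1 / p))" for n
  proof -
    have "u n \<noteq> \<infinity>"
      using u[of n] r by (auto simp: ennpowr_def top_unique)
    then obtain q where q: "u n = ennreal q" "0 \<le> q"
      by (cases "u n") auto
    then have "q powr p \<le> r"
      using u[of n] r by (simp add: ennpowr_ennreal)
    then have "(q powr p) powr (1 / p) \<le> r powr (1 / p)"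
      using p by (intro powr_mono2) auto
    then show ?thesis
      using p q by (auto simp: powr_powr intro: ennreal_leI)
  qed
  then have "ennpowr (SUP n. u n) p \<le> ennpowr (ennreal (r powr (1 / p))) p"
    using p by (intro ennpowr_mono SUP_least) auto
  also have "\<dots> = T"
    using p r by (simp add: ennpowr_ennreal powr_powr)
  finally show ?thesis .
qed simp

section \<open>Growth of the logarithmic weights\<close>

lemma log_weight_mono: "i \<le> j \<Longrightarrow> log_weight i \<le> log_weight j"
  unfolding log_weight_def by (intro sum_mono2) auto

lemma log_weight_pos: "2 \<le> n \<Longrightarrow> 0 < log_weight n"
  using log_weight_mono[of 2 n] by (simp add: log_weight_def numeral_2_eq_2)

lemma log_weight_diff:
  assumes "1 \<le> i" "i \<le> j"
  shows "log_weight j = log_weight i + (\<Sum>k=i..<j. 1 / real k)"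
  unfolding log_weight_def using assms by (simp add: sum.atLeastLessThan_concat)

text \<open>Each of the \<open>i\<close> new terms is at least 1/(2i). Iterated along
  \<open>M\<close>, this makes \<open>log_weight (M s)\<close> grow at least linearly in
  \<open>s\<close>.\<close>

lemma log_weight_double_le:
  assumes "1 \<le> i"
  shows "log_weight i + 1 / 2 \<le> log_weight (2 * i)"
proof -
  have "1 / 2 = (\<Sum>k=i..<2*i. 1 / real (2 * i))"
    using assms by simp
  also have "\<dots> \<le> (\<Sum>k=i..<2*i. 1 / real k)"
    using assms by (intro sum_mono frac_le) auto
  finally show ?thesis
    using log_weight_diff[of i "2 * i"] assms by simp
qed

text \<open>Each of the (q - 1) i new terms is at most 1/i. Iterated with \<open>q = m s\<close>,
  this gives the matching linear upper bound when \<open>m\<close> is bounded.\<close>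

lemma log_weight_mult_le:
  assumes "1 \<le> i" "1 \<le> q"
  shows "log_weight (q * i) \<le> log_weight i + q"
proof -
  have "(\<Sum>k=i..<q*i. 1 / real k) \<le> (\<Sum>k=i..<q*i. 1 / real i)"
    using assms by (intro sum_mono frac_le) auto
  also have "\<dots> \<le> q"
    using assms by (simp add: field_simps of_nat_diff)
  finally show ?thesis
    using log_weight_diff[of i "q * i"] assms by simp
qed

text \<open>Every requirement on the next index holds for all large indices, so dependent choice
  applies. In the application \<open>w\<close> is the weight of a block, \<open>G\<close> bounds the
  sum of all coefficients up to and including a block, and \<open>h\<close> is the size that this
  sum may have when the next block is reached.\<close>

lemma sparse_sequence:
  fixes w h G :: "nat \<Rightarrow> real"
  assumes w: "w \<longlonglongrightarrow> 0" and h: "filterlim h at_top sequentially"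
  obtains t :: "nat \<Rightarrow> nat" where "strict_mono t" "\<And>k. N \<le> t k" "\<And>k. w (t k) \<le> (1 / 2) ^ k"
    "\<And>k. G (t k) \<le> h (t (Suc k))"
proof -
  have w': "\<forall>\<^sub>F t in sequentially. w t \<le> (1 / 2) ^ k" for k
    using order_tendstoD(2)[OF w, of "(1 / 2) ^ k"] by (auto elim: eventually_mono)
  have h': "\<forall>\<^sub>F t in sequentially. y \<le> h t" for y
    using h by (simp add: filterlim_at_top)
  have "\<exists>t. \<forall>k. (N \<le> t k \<and> w (t k) \<le> (1 / 2) ^ k) \<and> (t k < t (Suc k) \<and> G (t k) \<le> h (t (Suc k)))"
  proof (rule dependent_nat_choice)
    have "\<forall>\<^sub>F t in sequentially. N \<le> t \<and> w t \<le> (1 / 2) ^ 0"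
      by (intro eventually_conj w' eventually_ge_at_top)
    then show "\<exists>t. N \<le> t \<and> w t \<le> (1 / 2) ^ 0"
      by (rule eventually_happens'[OF sequentially_bot])
  next
    fix t k
    have "\<forall>\<^sub>F t' in sequentially. (N \<le> t' \<and> w t' \<le> (1 / 2) ^ Suc k) \<and> (t < t' \<and> G t \<le> h t')"
      by (intro eventually_conj w' h' eventually_ge_at_top eventually_gt_at_top)
    then show "\<exists>t'. (N \<le> t' \<and> w t' \<le> (1 / 2) ^ Suc k) \<and> (t < t' \<and> G t \<le> h t')"
      by (rule eventually_happens'[OF sequentially_bot])
  qed
  then show ?thesis
    using that by (metis strict_mono_Suc_iff)
qed

subsection \<open>Vilenkin characters\<close>

locale vilenkin_system =
  fixes m :: "nat \<Rightarrow> nat"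
  assumes m_ge_2: "2 \<le> m k"
begin

abbreviation M :: "nat \<Rightarrow> nat" where "M \<equiv> gen_power m"
abbreviation \<psi> :: "nat \<Rightarrow> (nat \<Rightarrow> nat) \<Rightarrow> complex" where "\<psi> \<equiv> vilenkin_fun m"
abbreviation \<mu> :: "(nat \<Rightarrow> nat) measure" where "\<mu> \<equiv> vilenkin_measure m"
abbreviation cyl :: "nat \<Rightarrow> (nat \<Rightarrow> nat) set" where "cyl s \<equiv> vilenkin_cylinder m s (\<lambda>_. 0)"

sublocale prob_space \<mu>
  using prob_space_vilenkin_measure m_ge_2 .

lemma m_pos: "0 < m k"
  using m_ge_2[of k] by simp

lemma M_pos: "0 < M k"
  by (induction k) (auto simp: m_pos)

lemma less_M: "n < M n"
  using m_ge_2 by (rule less_gen_power)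

lemma M_Suc_ge: "2 * M k \<le> M (Suc k)"
  using m_ge_2[of k] by simp

lemma M_mono: "i \<le> j \<Longrightarrow> M i \<le> M j"
proof (induction j rule: nat_induct_at_least)
  case (Suc j)
  then show ?case
    using M_Suc_ge[of j] by linarith
qed simp

lemma M_ge_power2: "2 ^ k \<le> M k"
proof (induction k)
  case (Suc k)
  then show ?case
    using M_Suc_ge[of k] unfolding power_Suc by linarith
qed simp

lemma M_dvd: "i \<le> j \<Longrightarrow> M i dvd M j"
  by (induction j rule: nat_induct_at_least) auto

lemma gen_digit_ge: "n < M N \<Longrightarrow> N \<le> k \<Longrightarrow> gen_digit m n k = 0"
  using M_mono[of N k] by (simp add: gen_digit_def)

lemma vilenkin_fun_eq_prod:
  assumes "n < M N"
  shows "\<psi> n x = (\<Prod>k<N. rademacher m k x ^ gen_digit m n k)"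
  unfolding vilenkin_fun_def
  by (rule prod.mono_neutral_left) (auto simp: gen_digit_ge[OF assms] not_less[symmetric] intro: ccontr)

lemma gen_digit_shift:
  assumes "j < M s" "q < m s" "k \<le> s"
  shows "gen_digit m (q * M s + j) k = (if k = s then q else gen_digit m j k)"
proof (cases "k = s")
  case True
  then show ?thesis
    using assms by (simp add: gen_digit_def)
next
  case False
  \<comment> \<open>For \<open>k < s\<close>, division by \<open>M k\<close> turns the added term
    \<open>q * M s\<close> into a multiple of \<open>m k\<close>, which leaves the digit
    unchanged.\<close>
  then obtain R where R: "M s = M (Suc k) * R"
    using M_dvd[of "Suc k" s] assms(3) by (auto simp: dvd_def)
  have "(q * M s + j) div M k = (M k * (m k * (R * q)) + j) div M k"
    unfolding R by (simp add: ac_simps)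
  also have "\<dots> = m k * (R * q) + j div M k"
    using M_pos[of k] by (subst div_mult_self4) auto
  finally have "(q * M s + j) div M k mod m k = (m k * (R * q) + j div M k) mod m k"
    by (rule arg_cong)
  then show ?thesis
    using False by (simp only: gen_digit_def mod_mult_self4 if_False)
qed

lemma M_shift_less:
  assumes "j < M s" "q < m s"
  shows "q * M s + j < M (Suc s)"
proof -
  have "q * M s + j < Suc q * M s"
    using assms by simp
  also have "\<dots> \<le> m s * M s"
    using assms by (intro mult_right_mono) auto
  finally show ?thesis
    by simp
qed

lemma vilenkin_fun_shift:
  assumes "j < M s" "q < m s"
  shows "\<psi> (q * M s + j) x = rademacher m s x ^ q * \<psi> j x"
proof -
  have "\<psi> (q * M s + j) x = (\<Prod>k<Suc s. rademacher m k x ^ gen_digit m (q * M s + j) k)"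
    using M_shift_less[OF assms] by (rule vilenkin_fun_eq_prod)
  also have "\<dots> = rademacher m s x ^ q * (\<Prod>k<s. rademacher m k x ^ gen_digit m j k)"
    using assms by (simp add: gen_digit_shift del: gen_power.simps)
  finally show ?thesis
    using assms by (simp add: vilenkin_fun_eq_prod)
qed

lemma rademacher_eq_cis: "rademacher m k x = cis (2 * pi * (real (x k) / real (m k)))"
  by (simp add: rademacher_def cis_conv_exp ac_simps)

lemma norm_rademacher [simp]: "norm (rademacher m k x) = 1"
  by (simp only: rademacher_eq_cis norm_cis)

lemma norm_vilenkin_fun [simp]: "norm (\<psi> n x) = 1"
  by (simp add: vilenkin_fun_def norm_power flip: prod_norm)

lemma cyl_antimono: "i \<le> j \<Longrightarrow> cyl j \<subseteq> cyl i"
  by (auto simp: vilenkin_cylinder_def)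

lemma vilenkin_fun_cyl:
  assumes "x \<in> cyl s" "j < M s"
  shows "\<psi> j x = 1"
  using assms by (auto simp: vilenkin_fun_eq_prod vilenkin_cylinder_def rademacher_def intro!: prod.neutral)

lemma rademacher_power_m: "rademacher m k x ^ m k = 1"
proof -
  have "rademacher m k x ^ m k = exp (of_nat (m k) * (2 * of_real pi * \<i> * of_nat (x k) / of_nat (m k)))"
    unfolding rademacher_def exp_of_nat_mult ..
  also have "of_nat (m k) * (2 * of_real pi * \<i> * of_nat (x k) / of_nat (m k)) = 2 * of_real pi * \<i> * (of_nat (x k) :: complex)"
    using m_pos[of k] by simp
  also have "exp \<dots> = 1"
    using exp_integer_2pi[of "of_nat (x k)"] by (simp add: ac_simps)
  finally show ?thesis .
qed

lemma rademacher_eq_1_iff: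
  assumes "x k < m k"
  shows "rademacher m k x = 1 \<longleftrightarrow> x k = 0"
proof
  assume "rademacher m k x = 1"
  then have "exp (\<i> * of_real (2 * pi * (x k / m k))) = 1"
    by (simp add: rademacher_def ac_simps)
  then obtain n :: int where "2 * pi * (x k / m k) = of_int (2 * n) * pi"
    unfolding exp_eq_1 by auto
  then have "pi * (2 * (x k / m k)) = pi * (2 * of_int n)"
    by (simp add: ac_simps)
  then have n: "real (x k) / real (m k) = of_int n"
    by (subst (asm) mult_cancel_left) simp
  moreover have "0 \<le> real (x k) / real (m k)" "real (x k) / real (m k) < 1"
    using assms by auto
  ultimately have "n = 0"
    by linarith
  then show "x k = 0"
    using m_pos[of k] n by simp
qed (simp add: rademacher_def)

text \<open>Writing an index below \<open>M (Suc s)\<close> as \<open>q * M s + j\<close> factors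
  the kernel into the previous one and a geometric sum of powers of an \<open>m s\<close>-th root of
  unity. That sum is \<open>m s\<close> if the root is 1, that is, if \<open>x s = 0\<close>, and
  vanishes otherwise.\<close>

lemma dirichlet_kernel_M:
  assumes "x \<in> space \<mu>"
  shows "(\<Sum>j<M s. \<psi> j x) = (if x \<in> cyl s then of_nat (M s) else 0)"
proof (induction s)
  case 0
  then show ?case
    using assms by (simp add: vilenkin_cylinder_def vilenkin_fun_def gen_digit_def)
next
  case (Suc s)
  have x: "x s < m s"
    using assms by (simp add: space_vilenkin_measure)
  have "(\<Sum>j<M (Suc s). \<psi> j x) = (\<Sum>q<m s. \<Sum>j<M s. \<psi> (j + q * M s) x)"
    by (simp add: sum.nat_group[symmetric] sum.atLeastLessThan_shift_0[of _ "_ * _"] atLeast0LessThan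
        add.commute mult.commute)
  also have "\<dots> = (\<Sum>q<m s. rademacher m s x ^ q) * (\<Sum>j<M s. \<psi> j x)"
    by (simp add: sum_product vilenkin_fun_shift add.commute[of _ "_ * M s"])
  also have "\<dots> = (if x \<in> cyl (Suc s) then of_nat (M (Suc s)) else 0)"
  proof (cases "x s = 0")
    case True
    then have "rademacher m s x = 1"
      using rademacher_eq_1_iff[of x s] x by simp
    then show ?thesis
      unfolding Suc using True by (auto simp: vilenkin_cylinder_def less_Suc_eq)
  next
    case False
    then have "rademacher m s x \<noteq> 1"
      using rademacher_eq_1_iff[of x s] x by simp
    then have "(\<Sum>q<m s. rademacher m s x ^ q) = 0"
      using rademacher_power_m[of s x] by (simp add: sum_gp_strict)
    then show ?thesis
      using False by (auto simp: vilenkin_cylinder_def)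
  qed
  finally show ?case .
qed

section \<open>Translation of characters and orthonormality\<close>

lemma rademacher_add:
  "rademacher m k (vilenkin_add m a x) = rademacher m k a * rademacher m k x"
proof -
  \<comment> \<open>\<open>d\<close> counts the full turns removed by the reduction modulo
    \<open>m k\<close>; they contribute the factor 1.\<close>
  define d where "d = (a k + x k) div m k"
  have "real (a k + x k) = real (d * m k + (a k + x k) mod m k)"
    unfolding d_def by (subst div_mult_mod_eq) rule
  then have "(a k + x k) / real (m k) = d + ((a k + x k) mod m k) / real (m k)"
    using m_pos[of k] by (simp add: field_simps)
  then have "2 * pi * ((a k + x k) / real (m k)) = 2 * pi * d + 2 * pi * (((a k + x k) mod m k) / real (m k))"
    by (simp only: distrib_left)
  then have "cis (2 * pi * ((a k + x k) / real (m k)))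
      = cis (2 * pi * d) * cis (2 * pi * (((a k + x k) mod m k) / real (m k)))"
    by (simp only: cis_mult)
  also have "cis (2 * pi * d) = 1"
    by (rule cis_multiple_2pi) auto
  finally have "cis (2 * pi * ((a k + x k) / real (m k))) = cis (2 * pi * (((a k + x k) mod m k) / real (m k)))"
    by simp
  then show ?thesis
    by (simp add: rademacher_eq_cis vilenkin_add_def cis_mult distrib_left add_divide_distrib)
qed

lemma vilenkin_fun_add: "\<psi> n (vilenkin_add m a x) = \<psi> n a * \<psi> n x"
  by (simp add: vilenkin_fun_def rademacher_add power_mult_distrib prod.distrib)

lemma measurable_component: "(\<lambda>x. x k) \<in> \<mu> \<rightarrow>\<^sub>M count_space UNIV"
proof -
  have "(\<lambda>x. x k) \<in> \<mu> \<rightarrow>\<^sub>M uniform_count_measure {..<m k}"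
    unfolding vilenkin_measure_def by (rule measurable_component_singleton) simp
  moreover have "(\<lambda>x. x) \<in> uniform_count_measure {..<m k} \<rightarrow>\<^sub>M count_space UNIV"
    by (auto simp: measurable_def sets_uniform_count_measure space_uniform_count_measure)
  ultimately show ?thesis
    by (rule measurable_compose)
qed

lemma measurable_vilenkin_fun [measurable]: "\<psi> n \<in> borel_measurable \<mu>"
proof -
  have [measurable]: "rademacher m k \<in> borel_measurable \<mu>" for k
  proof -
    have "(\<lambda>x. (\<lambda>i. exp (2 * of_real pi * \<i> * of_nat i / of_nat (m k))) (x k)) \<in> borel_measurable \<mu>"
      by (rule measurable_compose[OF measurable_component]) simp
    then show ?thesis
      by (simp add: rademacher_def[abs_def])
  qed
  have "\<psi> n = (\<lambda>x. \<Prod>k | gen_digit m n k \<noteq> 0. rademacher m k x ^ gen_digit m n k)"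
    by (simp add: fun_eq_iff vilenkin_fun_def)
  then show ?thesis
    by simp
qed

lemma integrable_vilenkin_fun [simp]: "integrable \<mu> (\<psi> n)"
  by (rule integrable_const_bound[of _ 1]) auto

text \<open>Distinct indices differ in some digit \<open>k\<close>. The point whose only nonzero
  coordinate is a 1 at \<open>k\<close> reads off this digit: there \<open>\<psi> n\<close> equals
  \<open>z ^ gen_digit m n k\<close> with \<open>z\<close> a primitive \<open>m k\<close>-th root of
  unity.\<close>

lemma vilenkin_fun_distinguish:
  assumes "i \<noteq> j"
  obtains a where "\<psi> i a * cnj (\<psi> j a) \<noteq> 1"
proof -
  define N where "N = Suc (max i j)"
  have N: "i < M N" "j < M N"
    using less_M[of N] by (simp_all add: N_def del: gen_power.simps)
  have "(\<Sum>k<N. gen_digit m i k * M k) \<noteq> (\<Sum>k<N. gen_digit m j k * M k)"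
    using assms N unfolding gen_digit_expansion[symmetric] by simp
  then obtain k where k: "k < N" "gen_digit m i k \<noteq> gen_digit m j k"
    by (metis (no_types, lifting) lessThan_iff sum.cong)
  define a :: "nat \<Rightarrow> nat" where "a = (\<lambda>l. if l = k then 1 else 0)"
  define z where "z = rademacher m k a"
  have z: "z = cis (2 * pi / m k)"
    by (simp add: z_def a_def rademacher_eq_cis)
  have \<psi>: "\<psi> n a = z ^ gen_digit m n k" if "n < M N" for n
  proof -
    have "rademacher m l a ^ gen_digit m n l = (if l = k then z ^ gen_digit m n k else 1)" for l
      by (simp add: z_def) (simp add: rademacher_def a_def)
    then show ?thesis
      using that k by (simp add: vilenkin_fun_eq_prod)
  qed
  have "\<psi> i a * cnj (\<psi> j a) \<noteq> 1"
  proof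
    assume "\<psi> i a * cnj (\<psi> j a) = 1"
    then have "\<psi> i a * cnj (\<psi> j a) * \<psi> j a = \<psi> j a"
      by simp
    moreover have "cnj (\<psi> j a) * \<psi> j a = 1"
      by (metis complex_norm_square mult.commute norm_vilenkin_fun of_real_1 one_power2)
    ultimately have "z ^ gen_digit m i k = z ^ gen_digit m j k"
      using \<psi>[OF N(1)] \<psi>[OF N(2)] by (metis mult.assoc mult_1_left mult_1_right)
    moreover have "inj_on (\<lambda>l. z ^ l) {..<m k}"
    proof (rule linorder_inj_onI')
      fix u v assume uv: "u \<in> {..<m k}" "v \<in> {..<m k}" "u < v"
      show "z ^ u \<noteq> z ^ v"
      proof
        assume "z ^ u = z ^ v"
        then have "z ^ u * z ^ (v - u) = z ^ u * 1"
          using uv(3) by (metis le_add_diff_inverse less_imp_le mult_1_right power_add)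
        then have "z ^ (v - u) = 1"
          by (subst (asm) mult_cancel_left) (simp add: z)
        \<comment> \<open>Seen as a value of the Rademacher function at a point with coordinate
          \<open>v - u < m k\<close>, the power can be 1 only if \<open>v - u = 0\<close>.\<close>
        moreover have "z ^ (v - u) = rademacher m k (\<lambda>_. v - u)"
          unfolding z Complex.DeMoivre rademacher_eq_cis by (rule arg_cong[of _ _ cis]) simp
        moreover have "v - u < m k"
          using uv by (simp add: less_imp_diff_less)
        ultimately show False
          using rademacher_eq_1_iff[of "\<lambda>_. v - u" k] uv(3) by simp
      qed
    qed
    ultimately show False
      using k(2) gen_digit_less[OF m_ge_2] by (auto dest!: inj_onD)
  qed
  then show ?thesis
    by (rule that)
qed

lemma integral_translate:
  fixes g :: "(nat \<Rightarrow> nat) \<Rightarrow> complex"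
  assumes [measurable]: "g \<in> borel_measurable \<mu>"
  shows "(\<integral>x. g (vilenkin_add m a x) \<partial>\<mu>) = (\<integral>x. g x \<partial>\<mu>)"
proof -
  have "vilenkin_add m a \<in> \<mu> \<rightarrow>\<^sub>M \<mu>"
    unfolding vilenkin_add_def
  proof (subst (2) vilenkin_measure_def, rule measurable_PiM_single')
    fix k :: nat
    have "(\<lambda>i. (a k + i) mod m k) \<in> count_space UNIV \<rightarrow>\<^sub>M uniform_count_measure {..<m k}"
      by (auto simp: measurable_def space_uniform_count_measure m_pos)
    then show "(\<lambda>x. (a k + x k) mod m k) \<in> \<mu> \<rightarrow>\<^sub>M uniform_count_measure {..<m k}"
      by (rule measurable_compose[OF measurable_component])
  qed (auto simp: space_uniform_count_measure m_pos)
  then have "(\<integral>x. g (vilenkin_add m a x) \<partial>\<mu>) = (\<integral>x. g x \<partial>distr \<mu> \<mu> (vilenkin_add m a))"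
    by (simp add: integral_distr)
  then show ?thesis
    by (simp only: vilenkin_measure_translation_invariant[OF m_ge_2])
qed

lemma measurable_cnj_vilenkin_fun [measurable]: "(\<lambda>x. cnj (\<psi> n x)) \<in> borel_measurable \<mu>"
  by (rule measurable_compose[OF measurable_vilenkin_fun])
     (intro borel_measurable_continuous_onI continuous_intros)

text \<open>For \<open>i \<noteq> j\<close> the integrand is a character, so translation by
  \<open>a\<close> multiplies the integral by the value at \<open>a\<close>. Invariance of the
  measure and a value different from 1 force the integral to be 0.\<close>

lemma vilenkin_fun_orthonormal:
  "(\<integral>x. \<psi> i x * cnj (\<psi> j x) \<partial>\<mu>) = (if i = j then 1 else 0)"
proof (cases "i = j")
  case True
  have "\<psi> j x * cnj (\<psi> j x) = 1" for x
    by (metis complex_norm_square norm_vilenkin_fun of_real_1 one_power2)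
  then show ?thesis
    using True prob_space by simp
next
  case False
  obtain a where a: "\<psi> i a * cnj (\<psi> j a) \<noteq> 1"
    using vilenkin_fun_distinguish[OF False] .
  have "(\<integral>x. \<psi> i x * cnj (\<psi> j x) \<partial>\<mu>)
      = (\<integral>x. \<psi> i a * cnj (\<psi> j a) * (\<psi> i x * cnj (\<psi> j x)) \<partial>\<mu>)"
    by (subst integral_translate[of _ a, symmetric]) (simp_all add: vilenkin_fun_add ac_simps)
  also have "\<dots> = \<psi> i a * cnj (\<psi> j a) * (\<integral>x. \<psi> i x * cnj (\<psi> j x) \<partial>\<mu>)"
    by simp
  finally show ?thesis
    using a False by (metis mult_cancel_right1)
qed

section \<open>Cylinders: measure and filtration\<close>

lemma sets_cyl [measurable]: "cyl s \<in> sets \<mu>"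
proof -
  have [measurable]: "(\<lambda>x. x k) \<in> \<mu> \<rightarrow>\<^sub>M count_space UNIV" for k
    by (rule measurable_component)
  have "{x \<in> space \<mu>. \<forall>j<s. x j = 0} \<in> sets \<mu>"
    by measurable
  then show ?thesis
    by (simp add: vilenkin_cylinder_def)
qed

text \<open>Integrate the Dirichlet kernel of order \<open>M s\<close> in two ways: by
  orthonormality only the index 0 survives and gives 1, and by the closed form the result is
  \<open>M s\<close> times the measure.\<close>

lemma measure_cyl: "measure \<mu> (cyl s) = 1 / M s"
proof -
  have "(\<integral>x. (\<Sum>j<M s. \<psi> j x) \<partial>\<mu>) = (\<Sum>j<M s. \<integral>x. \<psi> j x * cnj (\<psi> 0 x) \<partial>\<mu>)"
    by (simp add: vilenkin_fun_def[of m 0] gen_digit_def)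
  also have "\<dots> = 1"
    using M_pos[of s] by (simp add: vilenkin_fun_orthonormal)
  also have "(\<integral>x. (\<Sum>j<M s. \<psi> j x) \<partial>\<mu>) = (\<integral>x. of_nat (M s) * of_real (indicator (cyl s) x) \<partial>\<mu>)"
    by (rule Bochner_Integration.integral_cong) (auto simp: dirichlet_kernel_M indicator_def)
  also have "\<dots> = of_nat (M s) * of_real (measure \<mu> (cyl s))"
    using sets.sets_into_space[OF sets_cyl] by (simp add: Int_absorb2)
  finally have "of_real (real (M s) * measure \<mu> (cyl s)) = (of_real 1 :: complex)"
    by simp
  then show ?thesis
    using M_pos[of s] unfolding of_real_eq_iff by (simp add: field_simps)
qed

text \<open>A cylinder depends only on the first \<open>n\<close> coordinates of its centre, so
  there are finitely many of them. A function constant on each has preimages that are finite unions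
  of cylinders.\<close>

lemma borel_measurable_filtrationI:
  fixes g :: "(nat \<Rightarrow> nat) \<Rightarrow> complex"
  assumes "\<And>x y. x \<in> space \<mu> \<Longrightarrow> y \<in> vilenkin_cylinder m n x \<Longrightarrow> g y = g x"
  shows "g \<in> borel_measurable (vilenkin_filtration m n)"
proof (rule measurableI)
  fix S :: "complex set"
  let ?C = "vilenkin_cylinder m n"
  have sp: "space (vilenkin_filtration m n) = space \<mu>"
    by (simp add: vilenkin_filtration_def space_measure_of_conv)
  have "?C x = ?C (restrict x {..<n})" for x
    by (auto simp: vilenkin_cylinder_def)
  moreover have "restrict x {..<n} \<in> PiE {..<n} (\<lambda>k. {..<m k})" if "x \<in> space \<mu>" for x
    using that by (simp add: space_vilenkin_measure restrict_PiE_iff)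
  ultimately have "?C ` space \<mu> \<subseteq> ?C ` (PiE {..<n} (\<lambda>k. {..<m k}))"
    by blast
  then have fin: "finite (?C ` space \<mu>)"
    by (rule finite_subset) (auto intro: finite_PiE)
  have "g -` S \<inter> space \<mu> = \<Union> (?C ` {x \<in> space \<mu>. g x \<in> S})"
    using assms by (auto simp: vilenkin_cylinder_def)
  moreover have "\<Union> (?C ` {x \<in> space \<mu>. g x \<in> S}) \<in> sets (vilenkin_filtration m n)"
    by (intro sets.finite_Union finite_subset[OF _ fin])
       (auto simp: vilenkin_filtration_def vilenkin_cylinder_def intro!: in_measure_of)
  ultimately show "g -` S \<inter> space (vilenkin_filtration m n) \<in> sets (vilenkin_filtration m n)"
    by (simp add: sp)
qed simp

section \<open>Martingales with prescribed coefficients\<close>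

definition coeff_martingale :: "(nat \<Rightarrow> complex) \<Rightarrow> nat \<Rightarrow> (nat \<Rightarrow> nat) \<Rightarrow> complex" where
  "coeff_martingale c n x = (\<Sum>j<M n. c j * \<psi> j x)"

lemma fourier_coeff_coeff_martingale:
  "fourier_coeff m (coeff_martingale c n) i = (if i < M n then c i else 0)"
proof -
  have int: "integrable \<mu> (\<lambda>x. \<psi> j x * cnj (\<psi> i x))" for j
    by (rule integrable_const_bound[of _ 1]) (auto simp: norm_mult)
  have "fourier_coeff m (coeff_martingale c n) i = (\<integral>x. (\<Sum>j<M n. c j * (\<psi> j x * cnj (\<psi> i x))) \<partial>\<mu>)"
    by (simp add: fourier_coeff_def coeff_martingale_def sum_distrib_right mult.assoc)
  also have "\<dots> = (\<Sum>j<M n. c j * (\<integral>x. \<psi> j x * cnj (\<psi> i x) \<partial>\<mu>))"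
    using int by simp
  finally show ?thesis
    by (simp add: vilenkin_fun_orthonormal if_distrib cong: if_cong)
qed

text \<open>Characters with index below \<open>M n\<close> depend only on the first \<open>n\<close>
  coordinates, which gives adaptedness; orthonormality makes the partial sum of order
  \<open>M n\<close> truncate a later stage to stage \<open>n\<close>. Hence the coefficients may be
  chosen freely.\<close>

lemma vilenkin_martingale_coeff_martingale: "vilenkin_martingale m (coeff_martingale c)"
  unfolding vilenkin_martingale_def
proof (intro conjI allI impI ballI)
  fix n
  show "integrable \<mu> (coeff_martingale c n)"
    unfolding coeff_martingale_def[abs_def] by simp
  show "coeff_martingale c n \<in> borel_measurable (vilenkin_filtration m n)"
  proof (rule borel_measurable_filtrationI)
    fix x y assume "y \<in> vilenkin_cylinder m n x"
    then show "coeff_martingale c n y = coeff_martingale c n x"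
      unfolding coeff_martingale_def
      by (intro sum.cong arg_cong2[of _ _ _ _ "(*)"] refl)
         (auto simp: vilenkin_fun_eq_prod vilenkin_cylinder_def rademacher_def intro!: prod.cong)
  qed
next
  fix n k :: nat and x assume "n \<le> k"
  then have "M n \<le> M k"
    by (rule M_mono)
  then show "partial_sum m (M n) (coeff_martingale c k) x = coeff_martingale c n x"
    by (auto simp: partial_sum_def fourier_coeff_coeff_martingale coeff_martingale_def intro!: sum.cong)
qed

lemma martingale_coeff_coeff_martingale: "martingale_coeff m (coeff_martingale c) i = c i"
proof -
  \<comment> \<open>For \<open>k > i\<close> also \<open>i < M k\<close>, so the sequence under the
    limit is eventually constant.\<close>
  have "\<forall>\<^sub>F k in sequentially. fourier_coeff m (coeff_martingale c k) i = c i"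
    using eventually_gt_at_top[of i]
    by eventually_elim
       (use less_M in \<open>auto simp: fourier_coeff_coeff_martingale dest: less_trans\<close>)
  then show ?thesis
    unfolding martingale_coeff_def by (intro limI tendsto_eventually)
qed

lemma martingale_partial_sum_coeff_martingale:
  "martingale_partial_sum m n (coeff_martingale c) x = (\<Sum>k<n. c k * \<psi> k x)"
  by (simp add: martingale_partial_sum_def martingale_coeff_coeff_martingale)

subsection \<open>Norlund logarithmic means of block martingales\<close>

lemma log_weight_M_ge: "real s / 2 \<le> log_weight (M s)"
proof (induction s)
  case 0
  then show ?case
    by (simp add: log_weight_def)
next
  case (Suc s)
  have "log_weight (M s) + 1 / 2 \<le> log_weight (2 * M s)"
    using M_pos[of s] by (intro log_weight_double_le) simp
  also have "\<dots> \<le> log_weight (M (Suc s))"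
    by (intro log_weight_mono M_Suc_ge)
  finally show ?case
    using Suc by simp
qed

lemma log_weight_M_le:
  assumes "\<And>k. m k \<le> C"
  shows "log_weight (M s) \<le> real C * real s"
proof (induction s)
  case 0
  then show ?case
    by (simp add: log_weight_def)
next
  case (Suc s)
  have "log_weight (M (Suc s)) \<le> log_weight (M s) + m s"
    using M_pos[of s] m_pos[of s] log_weight_mult_le[of "M s" "m s"] by simp
  then show ?case
    using Suc assms[of s] by (simp add: algebra_simps)
qed

text \<open>Since \<open>M 0 = 1\<close>, the blocks start at 1 and the index 0 stands
  apart.\<close>

lemma sum_M_blocks:
  fixes f :: "nat \<Rightarrow> 'a :: comm_monoid_add"
  shows "(\<Sum>j<M n. f j) = f 0 + (\<Sum>i<n. \<Sum>j=M i..<M (Suc i). f j)"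
proof (induction n)
  case (Suc n)
  have "(\<Sum>j<M (Suc n). f j) = (\<Sum>j<M n. f j) + (\<Sum>j=M n..<M (Suc n). f j)"
    using M_mono[of n "Suc n"] unfolding lessThan_atLeast0
    by (subst sum.atLeastLessThan_concat) auto
  then show ?case
    using Suc by (simp add: add.assoc del: gen_power.simps)
qed simp

text \<open>The coefficients below \<open>M \<alpha>\<close> move every partial sum by at most their
  total, and averaging preserves this bound. The indices from \<open>M \<alpha>\<close> on all carry
  the same unimodular value on \<open>cyl s\<close>, so their contributions add up without
  cancellation.\<close>

lemma norm_norlund_log_mean_ge:
  fixes c :: "nat \<Rightarrow> real"
  assumes c: "\<And>j. 0 \<le> c j" and b: "\<And>j. M \<alpha> \<le> j \<Longrightarrow> j < M \<alpha> + M s \<Longrightarrow> c j = b"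
    and s: "s \<le> \<alpha>" and x: "x \<in> cyl s"
  defines "n \<equiv> M \<alpha> + M s"
  shows "b * M s * (log_weight (M s) - 1) / log_weight n - (\<Sum>j<M \<alpha>. c j)
    \<le> norm (norlund_log_mean m n (coeff_martingale (\<lambda>j. of_real (c j))) x)"
proof -
  define B where "B = (\<Sum>j<M \<alpha>. c j)"
  define P where "P k = (\<Sum>j<min k (M \<alpha>). of_real (c j) * \<psi> j x)" for k
  \<comment> \<open>Truncated subtraction makes the terms with \<open>k \<le> M \<alpha>\<close>
    vanish, so one sum over the full range covers both cases.\<close>
  define R where "R = (\<Sum>k=1..<n. real (k - M \<alpha>) / real (n - k))"
  let ?r = "rademacher m \<alpha> x"
  have b0: "0 \<le> b"
    using b[of "M \<alpha>"] c[of "M \<alpha>"] M_pos[of s] by simp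
  have n: "2 \<le> n"
    using M_pos[of \<alpha>] M_pos[of s] by (simp add: n_def)
  have Ms: "M s \<le> M \<alpha>"
    using s by (rule M_mono)
  have \<psi>: "\<psi> j x = ?r" if "M \<alpha> \<le> j" "j < n" for j
  proof -
    \<comment> \<open>The remainder \<open>j - M \<alpha>\<close> is below \<open>M s\<close>, so
      its character is 1 on \<open>cyl s\<close>; it is also below \<open>M \<alpha>\<close>, so the
      top digit is 1.\<close>
    have "\<psi> (1 * M \<alpha> + (j - M \<alpha>)) x = ?r ^ 1 * \<psi> (j - M \<alpha>) x"
      using that Ms m_ge_2[of \<alpha>] by (intro vilenkin_fun_shift) (auto simp: n_def)
    then show ?thesis
      using that vilenkin_fun_cyl[OF x, of "j - M \<alpha>"] by (simp add: n_def)
  qed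
  have S: "(\<Sum>j<k. of_real (c j) * \<psi> j x) = P k + of_real (b * real (k - M \<alpha>)) * ?r" if "k < n" for k
  proof (cases "k \<le> M \<alpha>")
    case False
    have "(\<Sum>j<k. of_real (c j) * \<psi> j x)
        = (\<Sum>j<M \<alpha>. of_real (c j) * \<psi> j x) + (\<Sum>j=M \<alpha>..<k. of_real (c j) * \<psi> j x)"
      using False unfolding lessThan_atLeast0 by (subst sum.atLeastLessThan_concat) auto
    also have "(\<Sum>j=M \<alpha>..<k. of_real (c j) * \<psi> j x) = (\<Sum>j=M \<alpha>..<k. of_real b * ?r)"
      using that by (intro sum.cong refl) (auto simp: b \<psi> n_def)
    finally show ?thesis
      using False by (simp add: P_def min_def)
  qed (simp add: P_def min_def)
  have P: "norm (P k) \<le> B" for k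
  proof -
    have "norm (P k) \<le> (\<Sum>j<min k (M \<alpha>). c j)"
      unfolding P_def by (rule sum_norm_le) (simp add: norm_mult c)
    also have "\<dots> \<le> B"
      unfolding B_def by (rule sum_mono2) (auto simp: c)
    finally show ?thesis .
  qed
  have rev: "(\<Sum>k=1..<n. f (n - k)) = (\<Sum>k=1..<n. f k)" for f :: "nat \<Rightarrow> real"
    by (rule sum.reindex_bij_witness[of _ "\<lambda>k. n - k" "\<lambda>k. n - k"]) auto
  have "norm (\<Sum>k=1..<n. P k / of_nat (n - k)) \<le> (\<Sum>k=1..<n. B * (1 / real (n - k)))"
    using P by (intro sum_norm_le) (auto simp: norm_divide divide_right_mono simp del: of_nat_diff)
  also have "\<dots> = B * log_weight n"
    by (simp only: sum_distrib_left[symmetric] rev[of "\<lambda>k. 1 / real k"] log_weight_def)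
  finally have lower: "norm (\<Sum>k=1..<n. P k / of_nat (n - k)) \<le> B * log_weight n" .
  \<comment> \<open>Under the reversal \<open>k\<close> to \<open>n - k\<close> the terms of
    \<open>R\<close> become (M s - k)/k = M s/k - 1 for \<open>k < M s\<close> and 0 beyond.
    Subtracting 1 in \<open>M s - 1\<close> terms costs less than \<open>M s\<close>.\<close>
  have "M s * (log_weight (M s) - 1) \<le> (\<Sum>k=1..<M s. M s / real k - 1)"
    using M_pos[of s] by (simp add: log_weight_def sum_subtractf sum_distrib_left algebra_simps of_nat_diff)
  also have "\<dots> \<le> (\<Sum>k=1..<M s. real (M s - k) / real k)"
    by (intro sum_mono) (auto simp: field_simps of_nat_diff)
  also have "\<dots> \<le> (\<Sum>k=1..<n. real (M s - k) / real k)"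
    by (rule sum_mono2) (auto simp: n_def)
  also have "\<dots> = (\<Sum>k=1..<n. real (M s - (n - k)) / real (n - k))"
    by (rule rev[symmetric])
  also have "\<dots> = R"
    unfolding R_def by (intro sum.cong refl) (auto simp: n_def)
  finally have R: "M s * (log_weight (M s) - 1) \<le> R" .
  have "(\<Sum>k=1..<n. martingale_partial_sum m k (coeff_martingale (\<lambda>j. of_real (c j))) x / of_nat (n - k))
      = (\<Sum>k=1..<n. P k / of_nat (n - k) + of_real (b * (real (k - M \<alpha>) / real (n - k))) * ?r)"
    by (intro sum.cong refl)
       (simp add: martingale_partial_sum_coeff_martingale S add_divide_distrib del: of_nat_diff)
  also have "\<dots> = (\<Sum>k=1..<n. P k / of_nat (n - k)) + of_real (b * R) * ?r"
    unfolding R_def by (simp add: sum.distrib sum_distrib_left sum_distrib_right del: of_nat_diff)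
  finally have eq: "norlund_log_mean m n (coeff_martingale (\<lambda>j. of_real (c j))) x
      = ((\<Sum>k=1..<n. P k / of_nat (n - k)) + of_real (b * R) * ?r) / of_real (log_weight n)"
    by (simp add: norlund_log_mean_def)
  have "b * M s * (log_weight (M s) - 1) - B * log_weight n
      \<le> b * R - norm (\<Sum>k=1..<n. P k / of_nat (n - k))"
    using lower mult_left_mono[OF R b0] by (simp add: mult.assoc)
  also have "\<dots> \<le> \<bar>b * R\<bar> - norm (\<Sum>k=1..<n. P k / of_nat (n - k))"
    by simp
  also have "\<dots> = norm (of_real (b * R) * ?r) - norm (\<Sum>k=1..<n. P k / of_nat (n - k))"
    by (simp add: norm_mult abs_mult)
  also have "\<dots> \<le> norm ((\<Sum>k=1..<n. P k / of_nat (n - k)) + of_real (b * R) * ?r)"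
    using norm_diff_ineq[of "of_real (b * R) * ?r" "\<Sum>k=1..<n. P k / of_nat (n - k)"]
    by (simp only: add.commute)
  finally have "(b * M s * (log_weight (M s) - 1) - B * log_weight n) / log_weight n
      \<le> norm ((\<Sum>k=1..<n. P k / of_nat (n - k)) + of_real (b * R) * ?r) / log_weight n"
    using log_weight_pos[OF n] by (intro divide_right_mono) auto
  also have "\<dots> = norm (norlund_log_mean m n (coeff_martingale (\<lambda>j. of_real (c j))) x)"
    unfolding eq norm_divide norm_of_real using log_weight_pos[OF n] by simp
  finally show ?thesis
    using log_weight_pos[OF n] unfolding B_def[symmetric] by (simp add: diff_divide_distrib)
qed

section \<open>Integration over the shells between successive cylinders\<close>

lemma measure_cyl_diff_ge: "1 / (2 * M s) \<le> measure \<mu> (cyl s - cyl (Suc s))"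
proof -
  have "measure \<mu> (cyl s - cyl (Suc s)) = 1 / M s - 1 / M (Suc s)"
    by (subst finite_measure_Diff) (auto simp: measure_cyl cyl_antimono simp del: gen_power.simps)
  moreover have "1 / M (Suc s) \<le> 1 / (2 * M s)"
    using M_Suc_ge[of s] M_pos[of s] by (intro divide_left_mono) (auto simp: m_pos simp del: gen_power.simps)
  ultimately show ?thesis
    by (simp del: gen_power.simps)
qed

text \<open>The shells \<open>cyl s - cyl (Suc s)\<close> are pairwise disjoint, so at each point at
  most one of the lower bounds is counted, and each shell keeps at least half of the measure
  \<open>1 / M s\<close> of its cylinder.\<close>

lemma nn_integral_ennpowr_ge:
  fixes K :: real
  assumes p: "0 < p" and K: "0 \<le> K" and S: "finite S"
    and F: "\<And>s x. s \<in> S \<Longrightarrow> x \<in> cyl s \<Longrightarrow> ennreal (K * M s) \<le> F x"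
  shows "ennreal (\<Sum>s\<in>S. (K * M s) powr p / (2 * M s)) \<le> (\<integral>\<^sup>+ x. ennpowr (F x) p \<partial>\<mu>)"
proof -
  let ?E = "\<lambda>s. cyl s - cyl (Suc s)"
  have "ennreal (\<Sum>s\<in>S. (K * M s) powr p / (2 * M s))
      \<le> ennreal (\<Sum>s\<in>S. (K * M s) powr p * measure \<mu> (?E s))"
    using mult_left_mono[OF measure_cyl_diff_ge] by (intro ennreal_leI sum_mono) force
  also have "\<dots> = (\<Sum>s\<in>S. ennreal ((K * M s) powr p) * emeasure \<mu> (?E s))"
    by (simp add: emeasure_eq_measure ennreal_mult flip: sum_ennreal)
  also have "\<dots> = (\<integral>\<^sup>+ x. (\<Sum>s\<in>S. ennreal ((K * M s) powr p) * indicator (?E s) x) \<partial>\<mu>)"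
    by (simp add: nn_integral_sum nn_integral_cmult_indicator)
  also have "\<dots> \<le> (\<integral>\<^sup>+ x. ennpowr (F x) p \<partial>\<mu>)"
  proof (rule nn_integral_mono)
    fix x
    show "(\<Sum>s\<in>S. ennreal ((K * M s) powr p) * indicator (?E s) x) \<le> ennpowr (F x) p"
    proof (cases "\<exists>s\<in>S. x \<in> ?E s")
      case True
      then obtain s where s: "s \<in> S" "x \<in> ?E s"
        by blast
      have "x \<notin> ?E s'" if "s' \<noteq> s" for s'
        using s(2) that cyl_antimono[of "Suc s" s'] cyl_antimono[of "Suc s'" s]
        by (cases s s' rule: linorder_cases) auto
      then have "(\<Sum>s\<in>S. ennreal ((K * M s) powr p) * indicator (?E s) x) = ennreal ((K * M s) powr p)"
        using s S by (subst sum.remove[of S s]) auto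
      also have "\<dots> = ennpowr (ennreal (K * M s)) p"
        using K by (simp add: ennpowr_ennreal)
      also have "\<dots> \<le> ennpowr (F x) p"
        using s p by (intro ennpowr_mono F) auto
      finally show ?thesis .
    next
      case False
      then have "(\<Sum>s\<in>S. ennreal ((K * M s) powr p) * indicator (?E s) x) = 0"
        by (intro sum.neutral) auto
      then show ?thesis
        by (simp only: zero_le)
    qed
  qed
  finally show ?thesis .
qed

section \<open>Coefficients constant on blocks\<close>

definition block_coeff :: "(nat \<Rightarrow> real) \<Rightarrow> nat \<Rightarrow> real" where
  "block_coeff b j = (if j = 0 then 0 else b (LEAST i. j < M (Suc i)))"

lemma block_coeff_0 [simp]: "block_coeff b 0 = 0"
  by (simp add: block_coeff_def)

text \<open>The blocks tile the positive integers, so the \<open>LEAST\<close> in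
  \<open>block_coeff\<close> finds the one containing \<open>j\<close>. The index 0 has its own case
  there, since \<open>0 < M 1\<close> would place it in block 0.\<close>

lemma block_coeff_block:
  assumes "M i \<le> j" "j < M (Suc i)"
  shows "block_coeff b j = b i"
proof -
  have "(LEAST i. j < M (Suc i)) = i"
  proof (rule Least_equality)
    fix l assume l: "j < M (Suc l)"
    show "i \<le> l"
      using assms(1) l M_mono[of "Suc l" i] by (force simp del: gen_power.simps)
  qed (rule assms)
  then show ?thesis
    using assms M_pos[of i] by (auto simp: block_coeff_def)
qed

lemma block_coeff_nonneg: "(\<And>i. 0 \<le> b i) \<Longrightarrow> 0 \<le> block_coeff b j"
  by (simp add: block_coeff_def)

lemma sum_block_coeff_le:
  assumes "\<And>i. 0 \<le> b i"
  shows "(\<Sum>j<M n. block_coeff b j) \<le> (\<Sum>i<n. b i * M (Suc i))"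
proof -
  have "(\<Sum>j<M n. block_coeff b j) = (\<Sum>i<n. \<Sum>j=M i..<M (Suc i). b i)"
    unfolding sum_M_blocks block_coeff_0 add_0 by (intro sum.cong refl block_coeff_block) auto
  also have "\<dots> \<le> (\<Sum>i<n. b i * M (Suc i))"
    using assms by (intro sum_mono) (simp add: mult.commute mult_left_mono del: gen_power.simps)
  finally show ?thesis .
qed

text \<open>The characters of block \<open>i\<close> sum to the difference of the Dirichlet kernels
  of orders \<open>M (Suc i)\<close> and \<open>M i\<close>, which vanishes off
  \<open>cyl i\<close>. On \<open>cyl i\<close> the number of terms gives the bound.\<close>

lemma norm_block_martingale_le:
  assumes b: "\<And>i. 0 \<le> b i" and x: "x \<in> space \<mu>"
  shows "norm (coeff_martingale (\<lambda>j. of_real (block_coeff b j)) n x)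
    \<le> (\<Sum>i<n. b i * M (Suc i) * indicator (cyl i) x)"
proof -
  have "coeff_martingale (\<lambda>j. of_real (block_coeff b j)) n x
      = (\<Sum>i<n. \<Sum>j=M i..<M (Suc i). of_real (b i) * \<psi> j x)"
    unfolding coeff_martingale_def sum_M_blocks block_coeff_0 of_real_0 mult_zero_left add_0
    by (intro sum.cong refl) (auto simp: block_coeff_block)
  also have "norm \<dots> \<le> (\<Sum>i<n. b i * M (Suc i) * indicator (cyl i) x)"
  proof (rule sum_norm_le)
    fix i
    show "norm (\<Sum>j=M i..<M (Suc i). of_real (b i) * \<psi> j x) \<le> b i * M (Suc i) * indicator (cyl i) x"
    proof (cases "x \<in> cyl i")
      case True
      have "norm (\<Sum>j=M i..<M (Suc i). of_real (b i) * \<psi> j x) \<le> (\<Sum>j=M i..<M (Suc i). b i)"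
        using b by (intro sum_norm_le) (simp add: norm_mult)
      also have "\<dots> \<le> b i * M (Suc i)"
        using b by (simp add: mult.commute mult_left_mono del: gen_power.simps)
      finally show ?thesis
        using True by simp
    next
      case False
      then have "x \<notin> cyl (Suc i)"
        using cyl_antimono[of i "Suc i"] by auto
      have "(\<Sum>j<M (Suc i). \<psi> j x) = (\<Sum>j<M i. \<psi> j x) + (\<Sum>j=M i..<M (Suc i). \<psi> j x)"
        using M_mono[of i "Suc i"] unfolding lessThan_atLeast0
        by (subst sum.atLeastLessThan_concat) auto
      then have "(\<Sum>j=M i..<M (Suc i). \<psi> j x) = 0"
        using False \<open>x \<notin> cyl (Suc i)\<close> x by (simp add: dirichlet_kernel_M del: gen_power.simps)
      then show ?thesis
        using False by (simp flip: sum_distrib_left del: gen_power.simps)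
    qed
  qed
  finally show ?thesis .
qed

text \<open>Subadditivity of the p-th power separates the blocks in a bound that is uniform in
  \<open>n\<close>, hence valid for the maximal function. Integrating it term by term gives the
  factor \<open>1 / M i\<close> from the measure of \<open>cyl i\<close>.\<close>

lemma nn_integral_block_martingale_le:
  assumes p: "0 < p" "p \<le> 1" and b: "\<And>i. 0 \<le> b i"
  shows "(\<integral>\<^sup>+ x. ennpowr (martingale_maximal (coeff_martingale (\<lambda>j. of_real (block_coeff b j))) x) p \<partial>\<mu>)
    \<le> (\<Sum>i. ennreal ((b i * M (Suc i)) powr p / M i))"
proof -
  let ?f = "coeff_martingale (\<lambda>j. of_real (block_coeff b j))"
  let ?t = "\<lambda>i. (b i * M (Suc i)) powr p"
  have "ennpowr (martingale_maximal ?f x) p \<le> (\<Sum>i. ennreal (?t i) * indicator (cyl i) x)"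
    if x: "x \<in> space \<mu>" for x
    unfolding martingale_maximal_def
  proof (rule ennpowr_SUP_le)
    fix n
    have "norm (?f n x) powr p \<le> (\<Sum>i<n. b i * M (Suc i) * indicator (cyl i) x) powr p"
      using norm_block_martingale_le[OF b x] p by (intro powr_mono2) auto
    also have "\<dots> \<le> (\<Sum>i<n. (b i * M (Suc i) * indicator (cyl i) x) powr p)"
      using p b by (intro powr_sum_le) (auto simp del: gen_power.simps)
    also have "\<dots> = (\<Sum>i<n. ?t i * indicator (cyl i) x)"
      by (intro sum.cong refl) (auto simp: indicator_def)
    finally have "ennpowr (ennreal (norm (?f n x))) p \<le> ennreal (\<Sum>i<n. ?t i * indicator (cyl i) x)"
      by (simp add: ennpowr_ennreal ennreal_leI)
    also have "\<dots> = (\<Sum>i<n. ennreal (?t i) * indicator (cyl i) x)"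
      by (subst sum_ennreal[symmetric]) (auto simp: indicator_def intro!: sum.cong)
    also have "\<dots> \<le> (\<Sum>i. ennreal (?t i) * indicator (cyl i) x)"
      by (rule sum_le_suminf) auto
    finally show "ennpowr (ennreal (norm (?f n x))) p \<le> (\<Sum>i. ennreal (?t i) * indicator (cyl i) x)" .
  qed (rule p)
  then have "(\<integral>\<^sup>+ x. ennpowr (martingale_maximal ?f x) p \<partial>\<mu>)
      \<le> (\<integral>\<^sup>+ x. (\<Sum>i. ennreal (?t i) * indicator (cyl i) x) \<partial>\<mu>)"
    by (rule nn_integral_mono)
  also have "\<dots> = (\<Sum>i. ennreal (?t i) * emeasure \<mu> (cyl i))"
    by (simp add: nn_integral_suminf nn_integral_cmult_indicator del: gen_power.simps)
  also have "\<dots> = (\<Sum>i. ennreal (?t i / M i))"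
    by (simp add: emeasure_eq_measure measure_cyl flip: ennreal_mult'')
  finally show ?thesis .
qed

text \<open>For each \<open>s\<close> the mean of order \<open>M (2 * t) + M s\<close> is used on
  \<open>cyl s\<close>. Its main term is at least \<open>b (2 * t) * M s / (12 * C)\<close>, and the
  assumption on the earlier coefficients lets them destroy at most half of it.\<close>

lemma nn_integral_norlund_log_maximal_ge:
  assumes p: "0 < p" and C: "\<And>k. m k \<le> C" and t: "4 \<le> t" and b: "\<And>i. 0 \<le> b i"
    and B: "(\<Sum>j<M (2 * t). block_coeff b j) \<le> b (2 * t) * M t / (24 * C)"
  shows "ennreal (\<Sum>s=t..<2*t. (b (2 * t) / (24 * C) * M s) powr p / (2 * M s))
    \<le> (\<integral>\<^sup>+ x. ennpowr (norlund_log_maximal m (coeff_martingale (\<lambda>j. of_real (block_coeff b j))) x) p \<partial>\<mu>)"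
proof (rule nn_integral_ennpowr_ge[OF p])
  have C2: "2 \<le> C"
    using m_ge_2[of 0] C[of 0] by simp
  let ?\<beta> = "b (2 * t)"
  show "0 \<le> ?\<beta> / (24 * C)"
    using b C2 by simp
  fix s x assume s: "s \<in> {t..<2*t}" and x: "x \<in> cyl s"
  define n where "n = M (2 * t) + M s"
  let ?f = "coeff_martingale (\<lambda>j. of_real (block_coeff b j))"
  have Ms: "M s \<le> M (2 * t)" "M t \<le> M s"
    using s by (auto intro: M_mono)
  have n: "2 \<le> n" "n \<le> M (Suc (2 * t))"
    using M_pos[of "2 * t"] M_pos[of s] Ms M_Suc_ge[of "2 * t"] by (simp_all add: n_def del: gen_power.simps)
  \<comment> \<open>The order \<open>n\<close> stays within block \<open>2 * t\<close>, so its
    weight is at most C (2t + 1) \<le> 3 C t.\<close>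
  have "log_weight n \<le> log_weight (M (Suc (2 * t)))"
    by (rule log_weight_mono) (rule n)
  also have "\<dots> \<le> real C * real (Suc (2 * t))"
    by (rule log_weight_M_le) (rule C)
  also have "\<dots> \<le> real C * (3 * real t)"
    using t by (intro mult_left_mono) auto
  finally have l: "log_weight n \<le> 3 * C * t"
    by simp
  \<comment> \<open>Here \<open>log_weight (M s) \<ge> s / 2 \<ge> t / 2\<close>, and
    \<open>t \<ge> 4\<close> absorbs the 1.\<close>
  have "real t / 4 \<le> log_weight (M s) - 1"
    using log_weight_M_ge[of s] s t by simp
  have "1 / (12 * C) = (real t / 4) / (3 * C * t)"
    using t by simp
  also have "\<dots> \<le> (log_weight (M s) - 1) / log_weight n"
    using \<open>real t / 4 \<le> _\<close> l log_weight_pos[OF n(1)] t by (intro frac_le) auto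
  finally have ratio: "1 / (12 * C) \<le> (log_weight (M s) - 1) / log_weight n" .
  have "(\<Sum>j<M (2 * t). block_coeff b j) \<le> ?\<beta> * M s / (24 * C)"
    using Ms b by (intro order_trans[OF B] divide_right_mono mult_left_mono) auto
  moreover have "?\<beta> * M s * (1 / (12 * C)) \<le> ?\<beta> * M s * ((log_weight (M s) - 1) / log_weight n)"
    using ratio b by (intro mult_left_mono) auto
  moreover have "?\<beta> * M s * (log_weight (M s) - 1) / log_weight n - (\<Sum>j<M (2 * t). block_coeff b j)
      \<le> norm (norlund_log_mean m n ?f x)"
    unfolding n_def
  proof (rule norm_norlund_log_mean_ge[OF _ _ _ x])
    fix j assume "M (2 * t) \<le> j" "j < M (2 * t) + M s"
    then show "block_coeff b j = ?\<beta>"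
      using n by (intro block_coeff_block) (auto simp: n_def simp del: gen_power.simps)
  qed (use b s in \<open>auto intro: block_coeff_nonneg\<close>)
  ultimately have "?\<beta> / (24 * C) * M s \<le> norm (norlund_log_mean m n ?f x)"
    by simp
  then show "ennreal (?\<beta> / (24 * C) * M s) \<le> norlund_log_maximal m ?f x"
    unfolding norlund_log_maximal_def using n(1) by (intro SUP_upper2[of n]) (auto intro: ennreal_leI)
qed simp

section \<open>Choice of the blocks and divergence\<close>

lemma exists_hardy_martingale_with_large_norlund_maximal:
  assumes p: "0 < p" "p \<le> 1" and C: "\<And>k. m k \<le> C"
  obtains c :: "nat \<Rightarrow> real" where
    "(\<integral>\<^sup>+ x. ennpowr (martingale_maximal (coeff_martingale (\<lambda>j. of_real (c j))) x) p \<partial>\<mu>) < \<infinity>"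
    "(\<integral>\<^sup>+ x. ennpowr (norlund_log_maximal m (coeff_martingale (\<lambda>j. of_real (c j))) x) p \<partial>\<mu>) = \<infinity>"
proof -
  \<comment> \<open>The weight tends to 0, so a sparse selection is summable, while
    \<open>t * w (2 * t)\<close>, the gain from \<open>t\<close> shells, is unbounded.\<close>
  define w :: "nat \<Rightarrow> real" where "w i = 1 / sqrt i" for i
  \<comment> \<open>The exponents normalise the block:
    \<open>(g i * M i) powr p / M i = w i\<close>.\<close>
  define g where "g i = w i powr (1 / p) * M i powr (1 / p - 1)" for i
  have g: "0 \<le> g i" for i
    by (simp add: g_def)
  have w0: "0 \<le> w i" for i
    by (simp add: w_def)
  have C2: "2 \<le> C"
    using m_ge_2[of 0] C[of 0] by simp
  define G where "G t = (\<Sum>i<Suc (2 * t). g i * M (Suc i))" for t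
  define h where "h t = g (2 * t) * M t / (24 * C)" for t
  have gp: "(g i) powr p = w i * M i powr (1 - p)" for i
  proof -
    have "(1 / p - 1) * p = 1 - p"
      using p by (simp add: field_simps)
    then show ?thesis
      using p w0[of i] by (simp add: g_def powr_mult powr_powr)
  qed
  have h: "filterlim h at_top sequentially"
  proof (rule filterlim_at_top_mono)
    \<comment> \<open>Since p \<le> 1 the factor \<open>M (2 * t) powr (1 / p - 1)\<close> is at
      least 1, and \<open>M t \<ge> 2 ^ t\<close> outgrows the polynomial decay of the power of
      \<open>w\<close>.\<close>
    define q where "q = 1 / p"
    have "q > 0"
      using p by (simp add: q_def)
    have "real (24 * C) > 0"
      using C2 by simp
    with \<open>q > 0\<close>
    show "filterlim (\<lambda>t::nat. (1 / sqrt (2 * real t)) powr q * 2 ^ t / real (24 * C)) at_top sequentially"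
      by real_asymp
    have "(1 / sqrt (2 * real t)) powr q * 2 ^ t / (24 * C) \<le> h t" for t
    proof -
      have "1 \<le> real (M (2 * t)) powr (1 / p - 1)"
        using M_pos[of "2 * t"] p by (intro ge_one_powr_ge_zero) (auto simp: field_simps)
      then have "(1 / sqrt (2 * real t)) powr q * 1 \<le> g (2 * t)"
        unfolding g_def q_def w_def by (intro mult_mono) auto
      moreover have "2 ^ t \<le> real (M t)"
        using M_ge_power2[of t] by (metis of_nat_le_iff of_nat_numeral of_nat_power)
      ultimately show ?thesis
        unfolding h_def using g by (intro divide_right_mono mult_mono) auto
    qed
    then show "\<forall>\<^sub>F t in sequentially. (1 / sqrt (2 * real t)) powr q * 2 ^ t / (24 * C) \<le> h t"
      by simp
  qed
  have "(\<lambda>t. w (2 * t)) \<longlonglongrightarrow> 0"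
    unfolding w_def of_nat_mult by real_asymp
  then obtain t where t: "strict_mono t" "\<And>k. 4 \<le> t k" "\<And>k. w (2 * t k) \<le> (1 / 2) ^ k"
    "\<And>k. G (t k) \<le> h (t (Suc k))"
    using sparse_sequence[OF _ h, of "\<lambda>t. w (2 * t)"] by metis
  have t_le: "t u \<le> t v \<longleftrightarrow> u \<le> v" for u v
    by (rule strict_mono_less_eq) (rule t)
  define b where "b i = (if i \<in> range (\<lambda>k. 2 * t k) then g i else 0)" for i
  have b: "0 \<le> b i" for i
    by (simp add: b_def g)
  let ?f = "coeff_martingale (\<lambda>j. of_real (block_coeff b j))"
  \<comment> \<open>Replacing \<open>M (Suc i)\<close> by \<open>m i * M i\<close> costs at most
    \<open>real C powr p\<close>, and the selected weights are dominated by a geometric series with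
    sum 2.\<close>
  have "(\<Sum>i<n. (b i * M (Suc i)) powr p / M i) \<le> real C powr p * 2" for n
  proof -
    let ?A = "{i \<in> {..<n}. i \<in> range (\<lambda>k. 2 * t k)}"
    have "(\<Sum>i<n. (b i * M (Suc i)) powr p / M i) = (\<Sum>i\<in>?A. (g i * M (Suc i)) powr p / M i)"
      by (rule sum.mono_neutral_cong_right) (auto simp: b_def)
    also have "\<dots> \<le> (\<Sum>i\<in>?A. real C powr p * w i)"
    proof (rule sum_mono)
      fix i
      have "(g i * M (Suc i)) powr p = real (m i) powr p * (w i * (M i powr (1 - p) * M i powr p))"
        by (simp add: powr_mult g gp)
      also have "M i powr (1 - p) * M i powr p = M i"
        using M_pos[of i] by (simp flip: powr_add)
      finally have "(g i * M (Suc i)) powr p / M i = real (m i) powr p * w i"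
        using M_pos[of i] by simp
      also have "\<dots> \<le> real C powr p * w i"
        using C p w0 by (intro mult_right_mono powr_mono2) auto
      finally show "(g i * M (Suc i)) powr p / M i \<le> real C powr p * w i" .
    qed
    also have "\<dots> = real C powr p * (\<Sum>i\<in>?A. w i)"
      by (simp add: sum_distrib_left)
    also have "(\<Sum>i\<in>?A. w i) \<le> 2"
    proof -
      have "?A \<subseteq> (\<lambda>k. 2 * t k) ` {..<n}"
      proof
        fix i assume "i \<in> ?A"
        then obtain k where "i = 2 * t k" "2 * t k < n"
          by auto
        moreover have "k \<le> t k"
          using t(1) by (rule strict_mono_imp_increasing)
        ultimately show "i \<in> (\<lambda>k. 2 * t k) ` {..<n}"
          by auto
      qed
      then have "(\<Sum>i\<in>?A. w i) \<le> (\<Sum>i\<in>(\<lambda>k. 2 * t k) ` {..<n}. w i)"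
        by (intro sum_mono2) (auto simp: w0)
      also have "\<dots> \<le> (\<Sum>k<n. w (2 * t k))"
        using sum_image_le[of "{..<n}" w "\<lambda>k. 2 * t k"] w0 by simp
      also have "\<dots> \<le> (\<Sum>k<n. (1 / 2) ^ k)"
        by (intro sum_mono t)
      also have "\<dots> \<le> 2"
        by (simp add: sum_gp_strict)
      finally show ?thesis .
    qed
    finally show ?thesis
      by (simp add: mult_left_mono)
  qed
  then have "(\<Sum>i<n. ennreal ((b i * M (Suc i)) powr p / M i)) \<le> ennreal (real C powr p * 2)" for n
    by (simp add: ennreal_leI del: gen_power.simps)
  then have "(\<Sum>i. ennreal ((b i * M (Suc i)) powr p / M i)) \<le> ennreal (real C powr p * 2)"
    by (intro suminf_le_const) auto
  with nn_integral_block_martingale_le[OF p b]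
  have "(\<integral>\<^sup>+ x. ennpowr (martingale_maximal ?f x) p \<partial>\<mu>) \<le> ennreal (real C powr p * 2)"
    by (rule order_trans)
  then have fin: "(\<integral>\<^sup>+ x. ennpowr (martingale_maximal ?f x) p \<partial>\<mu>) < \<infinity>"
    by (rule le_less_trans) simp
  define T where "T = (\<integral>\<^sup>+ x. ennpowr (norlund_log_maximal m ?f x) p \<partial>\<mu>)"
  have lower: "ennreal (sqrt (t k) * (1 / (24 * C)) powr p / (2 * sqrt 2)) \<le> T" for k
  proof -
    \<comment> \<open>The first selected block has only zero coefficients before it. For a later one
      the nonzero coefficients end with the preceding selected block, so \<open>G\<close> bounds
      their sum and the sparseness condition applies.\<close>
    have B: "(\<Sum>j<M (2 * t k). block_coeff b j) \<le> h (t k)"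
    proof (cases k)
      case 0
      have "b i = 0" if "i < 2 * t k" for i
      proof -
        have "i \<noteq> 2 * t u" for u
          using that t_le[of k u] 0 by auto
        then show ?thesis
          by (auto simp: b_def)
      qed
      then have "(\<Sum>i<2 * t k. b i * M (Suc i)) = 0"
        by simp
      then show ?thesis
        using sum_block_coeff_le[of b "2 * t k"] b g[of "2 * t k"]
        by (auto simp: h_def simp del: gen_power.simps intro: order_trans)
    next
      case (Suc l)
      have "b i = 0" if "i \<in> {Suc (2 * t l)..<2 * t k}" for i
      proof -
        have "i \<noteq> 2 * t u" for u
          using that t_le[of u l] t_le[of k u] Suc by (cases "u \<le> l") auto
        then show ?thesis
          by (auto simp: b_def)
      qed
      moreover have "t l < t k"
        using Suc t(1) by (simp add: strict_mono_def)
      ultimately have "(\<Sum>i<2 * t k. b i * M (Suc i)) = (\<Sum>i<Suc (2 * t l). b i * M (Suc i))"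
        by (intro sum.mono_neutral_right) (auto simp: not_less simp del: gen_power.simps)
      also have "\<dots> \<le> G (t l)"
        unfolding G_def by (intro sum_mono mult_right_mono) (auto simp: b_def g)
      also have "\<dots> \<le> h (t k)"
        using t(4) Suc by simp
      finally show ?thesis
        using sum_block_coeff_le[of b "2 * t k"] b by (auto intro: order_trans)
    qed
    have bk: "b (2 * t k) = g (2 * t k)"
      by (auto simp: b_def)
    \<comment> \<open>There are \<open>t k\<close> equal summands, and
      \<open>t k * w (2 * t k) = sqrt (t k) / sqrt 2\<close>.\<close>
    have "sqrt (t k) * (1 / (24 * C)) powr p / (2 * sqrt 2)
        = (\<Sum>s=t k..<2 * t k. w (2 * t k) * (1 / (24 * C)) powr p / 2)"
      using t(2)[of k] by (simp add: w_def real_sqrt_mult real_div_sqrt field_simps)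
    also have "\<dots> \<le> (\<Sum>s=t k..<2 * t k. (b (2 * t k) / (24 * C) * M s) powr p / (2 * M s))"
    proof (rule sum_mono)
      fix s assume s: "s \<in> {t k..<2 * t k}"
      have Ms: "0 < M s" "M s \<le> M (2 * t k)"
        using s M_pos by (auto intro: M_mono)
      have "(b (2 * t k) / (24 * C) * M s) powr p
          = w (2 * t k) * (1 / (24 * C)) powr p * (M (2 * t k) powr (1 - p) * M s powr p)"
        using g[of "2 * t k"] unfolding bk
        by (simp add: powr_mult powr_divide gp ac_simps)
      \<comment> \<open>As 1 - p \<ge> 0, enlarging \<open>M s\<close> to \<open>M (2 * t k)\<close>
        in one factor only helps; afterwards the \<open>M s\<close> cancels and the lower bound is
        the same for all \<open>s\<close>.\<close>
      moreover have "real (M s) \<le> M (2 * t k) powr (1 - p) * M s powr p"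
      proof -
        have "real (M s) = M s powr (1 - p) * M s powr p"
          using Ms by (simp flip: powr_add)
        also have "\<dots> \<le> M (2 * t k) powr (1 - p) * M s powr p"
          using Ms p by (intro mult_right_mono powr_mono2) auto
        finally show ?thesis .
      qed
      ultimately have "w (2 * t k) * (1 / (24 * C)) powr p * M s \<le> (b (2 * t k) / (24 * C) * M s) powr p"
        using w0 by (simp add: mult_left_mono)
      then have "w (2 * t k) * (1 / (24 * C)) powr p * M s / (2 * M s) \<le> (b (2 * t k) / (24 * C) * M s) powr p / (2 * M s)"
        by (rule divide_right_mono) simp
      then show "w (2 * t k) * (1 / (24 * C)) powr p / 2 \<le> (b (2 * t k) / (24 * C) * M s) powr p / (2 * M s)"
        using Ms by simp
    qed
    finally have "ennreal (sqrt (t k) * (1 / (24 * C)) powr p / (2 * sqrt 2))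
        \<le> ennreal (\<Sum>s=t k..<2 * t k. (b (2 * t k) / (24 * C) * M s) powr p / (2 * M s))"
      by (rule ennreal_leI)
    also have "\<dots> \<le> T"
      unfolding T_def
      by (rule nn_integral_norlund_log_maximal_ge) (use p C t(2) b B in \<open>auto simp: h_def bk\<close>)
    finally show ?thesis .
  qed
  have "T = \<infinity>"
  proof (rule ccontr)
    assume "T \<noteq> \<infinity>"
    then obtain r where r: "T = ennreal r" "0 \<le> r"
      by (cases T) auto
    define K where "K = (1 / (24 * C)) powr p / (2 * sqrt 2)"
    have "0 < K"
      using C2 by (simp add: K_def)
    obtain k :: nat where "(r / K)\<^sup>2 < real k"
      using reals_Archimedean2 by blast
    also have "real k \<le> real (t k)"
      using strict_mono_imp_increasing[OF t(1), of k] by simp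
    finally have "r / K < sqrt (t k)"
      by (rule real_less_rsqrt)
    then have "r < sqrt (t k) * K"
      using \<open>0 < K\<close> by (simp add: field_simps)
    moreover have "sqrt (t k) * K \<le> r"
      using lower[of k] r by (simp add: K_def)
    ultimately show False
      by simp
  qed
  with fin show ?thesis
    using that[of "block_coeff b"] by (simp add: T_def)
qed

end

theorem theorem4p27:
  fixes m :: "nat \<Rightarrow> nat" and p :: real
  assumes "\<And>k. 2 \<le> m k"
    and "bdd_above (range m)"
    and "0 < p" and "p \<le> 1"
  shows "\<exists>f\<in>hardy_space m p. Lp_quasinorm m p (norlund_log_maximal m f) = \<infinity>"
proof -
  interpret vilenkin_system m
    by standard (rule assms(1))
  obtain C where C: "\<And>k. m k \<le> C"
    using assms(2) by (auto simp: bdd_above_def)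
  obtain c :: "nat \<Rightarrow> real" where
    c: "(\<integral>\<^sup>+ x. ennpowr (martingale_maximal (coeff_martingale (\<lambda>j. of_real (c j))) x) p \<partial>\<mu>) < \<infinity>"
      "(\<integral>\<^sup>+ x. ennpowr (norlund_log_maximal m (coeff_martingale (\<lambda>j. of_real (c j))) x) p \<partial>\<mu>) = \<infinity>"
    using exists_hardy_martingale_with_large_norlund_maximal[OF assms(3,4) C] by metis
  \<comment> \<open>The outer power 1/p is infinite exactly when the integral is, so both claims
    reduce to the integrals.\<close>
  have "Lp_quasinorm m p (martingale_maximal (coeff_martingale (\<lambda>j. of_real (c j)))) \<noteq> \<infinity>"
    using c(1) by (simp only: Lp_quasinorm_def ennpowr_eq_infinity_iff)
  then have "coeff_martingale (\<lambda>j. of_real (c j)) \<in> hardy_space m p"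
    by (simp add: hardy_space_def vilenkin_martingale_coeff_martingale less_top)
  moreover have "Lp_quasinorm m p (norlund_log_maximal m (coeff_martingale (\<lambda>j. of_real (c j)))) = \<infinity>"
    using c(2) by (simp only: Lp_quasinorm_def ennpowr_eq_infinity_iff)
  ultimately show ?thesis
    by blast
qed

end
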